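(* Consider the discrete-time linear system $$x_{k+1} = A x_k + B u_k + E w_k,\qquad y_k = C x_k,\qquad k\in\mathbb{Z}_{\ge 0},$$ with $x_k\in\mathbb{R}^n$, $u_k\in\mathbb{R}^m$, $w_k\in\mathbb{R}^r$, $y_k\in\mathbb{R}^p$ and $A,B,C,E$ real matrices of compatible dimensions. Assume that $A$ is Schur stable, that $(A,B)$ is controllable, and that the columns of $C$ are linearly independent. Let $T\in\mathbb{Z}_{>0}$, let $u_0,\dots,u_{T-1}$ be an input sequence that is persistently exciting of order $n+1$, assume $w_0=\dots=w_{T-1}=0$, and let $y_0,\dots,y_T$ be the associated outputs of the system (from some initial state $x_0\in\mathbb{R}^n$). Put $$U_{1,T}=[u_0,\ u_1,\dots,u_{T-1}],\qquad Y_{1,T}=[y_0,\ y_1,\dots,y_{T-1}],\qquad Y^{\mathrm{diff}}_{1,T}=[y_1-y_0,\ y_2-y_1,\dots,y_T-y_{T-1}].$$ Then there exists $M\in\mathbb{R}^{T\times m}$ such that $$Y^{\mathrm{diff}}_{1,T}\,M=0,\qquad U_{1,T}\,M=I.$$ Moreover, for any $M$ satisfying these two equations, the steady-state transfer function $G:=C(I-A)^{-1}B$ of the system equals $G=Y_{1,T}\,M$.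
   Context: $A$ is Schur stable if all its eigenvalues have modulus strictly less than $1$; equivalently, for any $Q\succ 0$ there exists $P\succ 0$ with $A^{\mathsf T}PA-P=-Q$. $(A,B)$ is controllable if $[B,AB,\dots,A^{n-1}B]$ has rank $n$. Persistency of excitation: for a signal $z_0,\dots,z_{T-1}\in\mathbb{R}^\sigma$, $t\le T$ and $q\le T-t+1$, the Hankel matrix $Z_{t,q}\in\mathbb{R}^{\sigma t\times q}$ is the block matrix whose $(i,j)$ block ($1\le i\le t$, $1\le j\le q$) is $z_{i+j-2}$. The signal is persistently exciting of order $t$ if $Z_{t,q}$ has full row rank, i.e. $\operatorname{rank}(Z_{t,q})=\sigma t$, for some such $q$ (equivalently, for $q=T-t+1$). *)

theory Defs
  imports
    "Jordan_Normal_Form.DL_Rank"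
    "Jordan_Normal_Form.Char_Poly"
    "Jordan_Normal_Form.Gauss_Jordan_Elimination"
begin

definition schur_stable :: "real mat \<Rightarrow> bool" where
  "schur_stable A \<longleftrightarrow>
     (\<forall>ev. eigenvalue (map_mat complex_of_real A) ev \<longrightarrow> cmod ev < 1)"

(* The block matrix [B, A B, ..., A^(n-1) B]: column j lies in block j div m, where it is
   column j mod m. *)
definition controllability_matrix :: "real mat \<Rightarrow> real mat \<Rightarrow> real mat" where
  "controllability_matrix A B =
     (let n = dim_row A; m = dim_col B
      in mat n (n * m) (\<lambda>(i, j). (A ^\<^sub>m (j div m) * B) $$ (i, j mod m)))"

definition controllable :: "real mat \<Rightarrow> real mat \<Rightarrow> bool" where
  "controllable A B \<longleftrightarrow>
     vec_space.rank (dim_row A) (controllability_matrix A B) = dim_row A"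

(* Linear independence of the columns as a family: a repeated column is excluded by distinctness. *)
definition cols_lin_indpt :: "real mat \<Rightarrow> bool" where
  "cols_lin_indpt C \<longleftrightarrow> distinct (cols C) \<and>
     module.lin_indpt class_ring (module_vec TYPE(real) (dim_row C)) (set (cols C))"

(* Blocks are counted from 0 here, so that block (i, j) is z (i + j); s is the dimension of the
   signal. *)
definition hankel_matrix :: "nat \<Rightarrow> (nat \<Rightarrow> real vec) \<Rightarrow> nat \<Rightarrow> nat \<Rightarrow> real mat" where
  "hankel_matrix s z t q = mat (s * t) q (\<lambda>(i, j). z (i div s + j) $ (i mod s))"

(* Only z 0, ..., z (T - 1) matter. The condition t \<le> T is needed because subtraction on nat
   is truncated. *)
definition persistently_exciting ::
  "nat \<Rightarrow> nat \<Rightarrow> (nat \<Rightarrow> real vec) \<Rightarrow> nat \<Rightarrow> bool" where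
  "persistently_exciting s T z t \<longleftrightarrow> t \<le> T \<and>
     (\<exists>q \<in> {1..T - t + 1}. vec_space.rank (s * t) (hankel_matrix s z t q) = s * t)"

(* The system equations on the horizon 0, ..., T; the initial state x 0 is arbitrary. *)
definition system_trajectory ::
  "real mat \<Rightarrow> real mat \<Rightarrow> real mat \<Rightarrow> real mat \<Rightarrow> nat \<Rightarrow>
   (nat \<Rightarrow> real vec) \<Rightarrow> (nat \<Rightarrow> real vec) \<Rightarrow> (nat \<Rightarrow> real vec) \<Rightarrow> (nat \<Rightarrow> real vec) \<Rightarrow> bool" where
  "system_trajectory A B C E T x u w y \<longleftrightarrow>
     x 0 \<in> carrier_vec (dim_row A) \<and>
     (\<forall>k<T. x (Suc k) = A *\<^sub>v x k + B *\<^sub>v u k + E *\<^sub>v w k) \<and>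
     (\<forall>k\<le>T. y k = C *\<^sub>v x k)"

(* The inverse exists if A is Schur stable, see schur_stable_mat_inverse. *)
definition steady_state_gain :: "real mat \<Rightarrow> real mat \<Rightarrow> real mat \<Rightarrow> real mat" where
  "steady_state_gain A B C = C * the (mat_inverse (1\<^sub>m (dim_row A) - A)) * B"

lemma schur_stable_mat_inverse:
  assumes A: "A \<in> carrier_mat n n" and st: "schur_stable A"
  obtains N where "mat_inverse (1\<^sub>m n - A) = Some N" "N \<in> carrier_mat n n"
    "(1\<^sub>m n - A) * N = 1\<^sub>m n" "N * (1\<^sub>m n - A) = 1\<^sub>m n"
proof -
  have c: "1\<^sub>m n - A \<in> carrier_mat n n" using A by auto
  have "det (1\<^sub>m n - A) \<noteq> 0"
  proof
    assume "det (1\<^sub>m n - A) = 0"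
    then obtain v where v: "v \<in> carrier_vec n" "v \<noteq> 0\<^sub>v n" "(1\<^sub>m n - A) *\<^sub>v v = 0\<^sub>v n"
      using det_0_iff_vec_prod_zero[OF c] by blast
    have Av: "A *\<^sub>v v \<in> carrier_vec n" using A v(1) by auto
    have "v - A *\<^sub>v v = 0\<^sub>v n"
      using v A minus_mult_distrib_mat_vec[OF one_carrier_mat A v(1)] by simp
    then have eq: "A *\<^sub>v v = v"
      by (smt (verit) Av v(1) carrier_vecD eq_vecI index_minus_vec(1) index_zero_vec(1)
          right_minus_eq)
    let ?v = "map_vec complex_of_real v"
    have "map_mat complex_of_real A *\<^sub>v ?v = ?v"
      using of_real_hom.mult_mat_vec_hom[OF A v(1)] eq by metis
    moreover have "?v \<noteq> 0\<^sub>v n" using v(1,2) by (auto simp: vec_eq_iff)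
    ultimately have "eigenvalue (map_mat complex_of_real A) 1"
      unfolding eigenvalue_def eigenvector_def using A v(1) by (intro exI[of _ ?v]) auto
    then show False using st unfolding schur_stable_def by fastforce
  qed
  from det_non_zero_imp_unit[OF c this, of "()"] mat_inverse(1)[OF c, of "()"]
  obtain N where "mat_inverse (1\<^sub>m n - A) = Some N" by blast
  with mat_inverse(2)[OF c] that show thesis by blast
qed

end

theory Submission
  imports Defs
begin

text \<open>
  Let \<open>X\<close> be the matrix of the states at times \<open>0, ..., T - 1\<close>. The system equations give
  \<open>Y = C X\<close> and \<open>Ydiff = C (A X + B U - X)\<close>. Hence, for every \<open>M\<close> with \<open>U M = I\<close>,
  \<open>Ydiff M = C (B - (I - A) X M)\<close>. Think of column \<open>i\<close> of \<open>X M\<close> as a candidate for the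
  equilibrium state under the constant input \<open>e\<^sub>i\<close>. As \<open>C\<close> is injective, \<open>Ydiff M = 0\<close>
  says exactly that the candidates are equilibria, \<open>(I - A) X M = B\<close>. Schur stability makes
  \<open>I - A\<close> invertible, so \<open>X M = (I - A)\<^sup>-\<^sup>1 B\<close> and \<open>Y M = C X M\<close> is the gain \<open>G\<close>.

  It remains to find an \<open>M\<close> with \<open>X M = (I - A)\<^sup>-\<^sup>1 B\<close> and \<open>U M = I\<close>. It exists if the
  matrix with blocks \<open>X\<close> and \<open>U\<close> has full row rank, and this is where controllability and
  excitation enter. Suppose \<open>\<xi>\<^sup>T x\<^sub>k + \<eta>\<^sup>T u\<^sub>k = 0\<close> for all \<open>k\<close>. The covectors
  \<open>\<xi>\<^sup>T, \<xi>\<^sup>T A, ..., \<xi>\<^sup>T A\<^sup>n\<close> are linearly dependent (\<open>krylov_dependence\<close>). Combining the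
  relations at \<open>n + 1\<close> successive times with the coefficients of this dependence eliminates
  the state, and a relation between \<open>n + 1\<close> successive inputs remains. Excitation of order
  \<open>n + 1\<close> makes its coefficients vanish (\<open>persistently_exciting_coeff_zero\<close>), and these
  coefficients determine \<open>\<eta>\<close> and all \<open>\<xi>\<^sup>T A\<^sup>l B\<close> triangularly
  (\<open>window_coefficients_vanish\<close>). So \<open>\<eta> = 0\<close>, and \<open>\<xi> = 0\<close> by controllability
  (\<open>controllable_imp_left_kernel_trivial\<close>).
\<close>

section \<open>Rank and kernels of real matrices\<close>

text \<open>
  Over the reals the Gram matrix \<open>K K\<^sup>T\<close> has no larger kernel than \<open>K\<^sup>T\<close>, because
  \<open>v \<bullet> K K\<^sup>T v\<close> is the squared length of \<open>K\<^sup>T v\<close>. So it is invertible, and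
  \<open>K\<^sup>T (K K\<^sup>T)\<^sup>-\<^sup>1\<close> is an explicit right inverse of \<open>K\<close>.
\<close>

lemma right_inverse_of_trivial_left_kernel:
  fixes K N :: "real mat"
  assumes K: "K \<in> carrier_mat k t" and N: "N \<in> carrier_mat k m"
    and ker: "\<And>v. v \<in> carrier_vec k \<Longrightarrow> K\<^sup>T *\<^sub>v v = 0\<^sub>v t \<Longrightarrow> v = 0\<^sub>v k"
  obtains M where "M \<in> carrier_mat t m" "K * M = N"
proof -
  let ?G = "K * K\<^sup>T"
  have Kt: "K\<^sup>T \<in> carrier_mat t k" and G: "?G \<in> carrier_mat k k" using K by auto
  have "det ?G \<noteq> 0"
  proof
    assume "det ?G = 0"
    then obtain v where v: "v \<in> carrier_vec k" "v \<noteq> 0\<^sub>v k" "?G *\<^sub>v v = 0\<^sub>v k"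
      using det_0_iff_vec_prod_zero[OF G] by blast
    have c: "K\<^sup>T *\<^sub>v v \<in> carrier_vec t" using Kt v(1) by auto
    have "(K\<^sup>T *\<^sub>v v) \<bullet> (K\<^sup>T *\<^sub>v v) = v \<bullet> (K *\<^sub>v (K\<^sup>T *\<^sub>v v))"
      by (rule transpose_vec_mult_scalar[OF K c v(1)])
    also have "K *\<^sub>v (K\<^sup>T *\<^sub>v v) = 0\<^sub>v k"
      using v(3) assoc_mult_mat_vec[OF K Kt v(1)] by simp
    finally have "(K\<^sup>T *\<^sub>v v) \<bullet> (K\<^sup>T *\<^sub>v v) = 0" using v(1) by simp
    then have "K\<^sup>T *\<^sub>v v = 0\<^sub>v t"
      using conjugate_square_eq_0_vec[OF c] by simp
    with ker v show False by blast
  qed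
  then obtain H where H: "H \<in> carrier_mat k k" "?G * H = 1\<^sub>m k"
    using det_non_zero_imp_unit[OF G, of "()"] mat_inverse(1)[OF G, of "()"] mat_inverse(2)[OF G]
    by (metis option.exhaust)
  have "K * (K\<^sup>T * (H * N)) = ?G * H * N"
    using assoc_mult_mat[OF K Kt mult_carrier_mat[OF H(1) N]] assoc_mult_mat[OF G H(1) N] by simp
  also have "\<dots> = N" using H N by simp
  finally show thesis using that[of "K\<^sup>T * (H * N)"] Kt H(1) N by auto
qed

text \<open>
  A maximal independent set of columns has \<open>k\<close> elements, hence is a basis of the whole space.
\<close>

lemma full_row_rank_imp_surjective:
  fixes M :: "real mat"
  assumes M: "M \<in> carrier_mat k q" and rank: "vec_space.rank k M = k"
    and v: "v \<in> carrier_vec k"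
  obtains w where "w \<in> carrier_vec q" "M *\<^sub>v w = v"
proof -
  interpret V: vec_space "TYPE(real)" k .
  let ?S = "set (cols M)"
  have S: "?S \<subseteq> carrier_vec k" using cols_dim[of M] M by auto
  obtain W where W: "maximal W (\<lambda>T. T \<subseteq> ?S \<and> V.lin_indpt T)"
    using maximal_exists_superset[of ?S "\<lambda>T. T \<subseteq> ?S \<and> V.lin_indpt T" "{}"]
      V.lin_dep_def by blast
  then have sub: "W \<subseteq> ?S" and li: "V.lin_indpt W" unfolding maximal_def by auto
  have "card W = k" using V.rank_card_indpt[OF M W] rank by simp
  then have "V.basis W"
    using V.dim_li_is_basis[OF V.fin_dim _ _ li] sub S finite_subset[OF sub] V.dim_is_n by auto
  then have "v \<in> V.span W" using v unfolding V.basis_def by auto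
  then have "v \<in> V.col_space M"
    using V.span_is_monotone[OF sub] unfolding V.col_space_def by auto
  then show thesis using V.col_space_eq[OF M] M that by auto
qed

text \<open>
  This is the form in which both rank hypotheses, controllability and persistency of excitation,
  are used. A vector orthogonal to all columns is itself in the column space, so it is
  orthogonal to itself.
\<close>

lemma full_row_rank_imp_trivial_left_kernel:
  fixes M :: "real mat"
  assumes M: "M \<in> carrier_mat k q" and rank: "vec_space.rank k M = k"
    and v: "v \<in> carrier_vec k" and z: "\<And>j. j < q \<Longrightarrow> v \<bullet> col M j = 0"
  shows "v = 0\<^sub>v k"
proof -
  obtain w where w: "w \<in> carrier_vec q" "M *\<^sub>v w = v"
    using full_row_rank_imp_surjective[OF M rank v] .
  have "M\<^sup>T *\<^sub>v v = 0\<^sub>v q"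
    using M v z by (intro eq_vecI) (auto simp: comm_scalar_prod[of v k])
  then have "v \<bullet> v = 0"
    using transpose_vec_mult_scalar[OF M w(1) v] w by simp
  then show ?thesis using conjugate_square_eq_0_vec[OF v] by simp
qed

text \<open>
  Padding with zero rows makes the matrix square without changing its kernel, and a zero row
  forces the determinant to vanish.
\<close>

lemma wide_matrix_kernel:
  fixes P :: "real mat"
  assumes P: "P \<in> carrier_mat k q" and less: "k < q"
  obtains a where "a \<in> carrier_vec q" "a \<noteq> 0\<^sub>v q" "P *\<^sub>v a = 0\<^sub>v k"
proof -
  let ?Q = "mat q q (\<lambda>(i, j). if i < k then P $$ (i, j) else 0)"
  have Q: "?Q \<in> carrier_mat q q" by simp
  have Qt: "?Q\<^sup>T \<in> carrier_mat q q" by simp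
  have "?Q\<^sup>T *\<^sub>v unit_vec q k = 0\<^sub>v q"
    using less by (intro eq_vecI) auto
  moreover have "unit_vec q k \<noteq> (0\<^sub>v q :: real vec)" using less by simp
  ultimately have "det ?Q\<^sup>T = 0"
    using det_0_iff_vec_prod_zero[OF Qt] unit_vec_carrier by blast
  then have "det ?Q = 0" using det_transpose[OF Q] by simp
  then obtain a where a: "a \<in> carrier_vec q" "a \<noteq> 0\<^sub>v q" "?Q *\<^sub>v a = 0\<^sub>v q"
    using det_0_iff_vec_prod_zero[OF Q] by blast
  have "P *\<^sub>v a = 0\<^sub>v k"
  proof (rule eq_vecI)
    fix i assume "i < dim_vec (0\<^sub>v k)"
    then have i: "i < k" by simp
    have "row P i = row ?Q i" using i less P by (intro eq_vecI) auto
    then have "(P *\<^sub>v a) $ i = (?Q *\<^sub>v a) $ i" using i less P by auto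
    then show "(P *\<^sub>v a) $ i = 0\<^sub>v k $ i" using a(3) i less by simp
  qed (use P in auto)
  with a that show thesis by blast
qed

section \<open>Dependence, excitation and controllability as statements on covectors\<close>

text \<open>
  The \<open>n + 1\<close> covectors \<open>\<xi>\<^sup>T A\<^sup>j\<close> with \<open>j \<le> n\<close> live in an \<open>n\<close>-dimensional space, hence are
  linearly dependent. This dependence replaces the characteristic polynomial
  of \<open>A\<close>: here only a nonzero coefficient is guaranteed, not a leading one equal to 1.
\<close>

lemma krylov_dependence:
  fixes A :: "real mat"
  assumes A: "A \<in> carrier_mat n n" and \<xi>: "\<xi> \<in> carrier_vec n"
  obtains a j where "j \<le> n" "a j \<noteq> 0"
    "\<And>v. v \<in> carrier_vec n \<Longrightarrow> (\<Sum>j\<le>n. a j * (\<xi> \<bullet> (A ^\<^sub>m j *\<^sub>v v))) = 0"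
proof -
  let ?r = "\<lambda>j. (A ^\<^sub>m j)\<^sup>T *\<^sub>v \<xi>"
  let ?P = "mat_of_cols n (map ?r [0..<Suc n])"
  have P: "?P \<in> carrier_mat n (Suc n)" using mat_of_cols_carrier(1)[of n "map ?r [0..<Suc n]"] by simp
  obtain a where a: "a \<in> carrier_vec (Suc n)" "a \<noteq> 0\<^sub>v (Suc n)" "?P *\<^sub>v a = 0\<^sub>v n"
    using wide_matrix_kernel[OF P] by blast
  obtain j where j: "j < Suc n" "a $ j \<noteq> 0"
    using a(1,2) by (metis carrier_vecD eq_vecI index_zero_vec)
  have "(\<Sum>j\<le>n. a $ j * (\<xi> \<bullet> (A ^\<^sub>m j *\<^sub>v v))) = 0" if v: "v \<in> carrier_vec n" for v
  proof -
    have rc: "?r j \<in> carrier_vec n" for j using A \<xi> by (metis mult_mat_vec_carrier pow_carrier_mat transpose_carrier_mat)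
    have "(?P\<^sup>T *\<^sub>v v) $ j = \<xi> \<bullet> (A ^\<^sub>m j *\<^sub>v v)" if "j < Suc n" for j
    proof -
      have "(?P\<^sup>T *\<^sub>v v) $ j = col ?P j \<bullet> v" using that by simp
      also have "col ?P j = ?r j" using that rc by (subst col_mat_of_cols) (auto simp del: upt_Suc)
      also have "?r j \<bullet> v = \<xi> \<bullet> (A ^\<^sub>m j *\<^sub>v v)"
        by (rule transpose_vec_mult_scalar[OF pow_carrier_mat[OF A] v \<xi>])
      finally show ?thesis .
    qed
    then have "(\<Sum>j\<le>n. a $ j * (\<xi> \<bullet> (A ^\<^sub>m j *\<^sub>v v))) = (?P\<^sup>T *\<^sub>v v) \<bullet> a"
      using a(1) unfolding scalar_prod_def
      by (auto intro!: sum.cong simp: atLeast0LessThan lessThan_Suc_atMost mult.commute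
          simp del: upt_Suc index_mult_mat_vec)
    also have "\<dots> = 0"
      using transpose_vec_mult_scalar[OF P a(1) v] a(3) v by simp
    finally show ?thesis .
  qed
  with that[of j "\<lambda>j. a $ j"] j show thesis by auto
qed

text \<open>
  The sum in the assumption is the product of the row vector of all \<open>c i j\<close> with column \<open>k\<close> of
  the Hankel matrix.
\<close>

lemma persistently_exciting_coeff_zero:
  assumes pe: "persistently_exciting s T z t"
    and zero: "\<And>k. k + t \<le> T \<Longrightarrow> (\<Sum>i<t. \<Sum>j<s. c i j * z (k + i) $ j) = 0"
    and ij: "i < t" "j < s"
  shows "c i j = 0"
proof -
  obtain q where q: "1 \<le> q" "q \<le> T - t + 1" "t \<le> T"
    and rank: "vec_space.rank (s * t) (hankel_matrix s z t q) = s * t"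
    using pe unfolding persistently_exciting_def by auto
  have H: "hankel_matrix s z t q \<in> carrier_mat (s * t) q"
    unfolding hankel_matrix_def by simp
  define v where "v = vec (s * t) (\<lambda>l. c (l div s) (l mod s))"
  have v: "v \<in> carrier_vec (s * t)" unfolding v_def by simp
  have "v \<bullet> col (hankel_matrix s z t q) k = 0" if k: "k < q" for k
  proof -
    let ?f = "\<lambda>l. c (l div s) (l mod s) * z (k + l div s) $ (l mod s)"
    have "v \<bullet> col (hankel_matrix s z t q) k = sum ?f {..<t * s}"
      unfolding scalar_prod_def v_def hankel_matrix_def using k
      by (auto intro!: sum.cong simp: atLeast0LessThan mult.commute add.commute)
    also have "\<dots> = (\<Sum>i<t. sum ?f {i * s..<i * s + s})"
      by (rule sum.nat_group[symmetric])
    also have "\<dots> = (\<Sum>i<t. \<Sum>j<s. c i j * z (k + i) $ j)"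
    proof (rule sum.cong[OF refl])
      fix i
      have "sum ?f {i * s..<i * s + s} = (\<Sum>j\<in>{0..<s}. ?f (j + i * s))"
        using sum.shift_bounds_nat_ivl[of ?f 0 "i * s" s] by (simp add: add.commute)
      also have "\<dots> = (\<Sum>j<s. c i j * z (k + i) $ j)"
        by (auto intro!: sum.cong simp: atLeast0LessThan)
      finally show "sum ?f {i * s..<i * s + s} = (\<Sum>j<s. c i j * z (k + i) $ j)" .
    qed
    also have "\<dots> = 0" using zero q k by simp
    finally show ?thesis .
  qed
  then have v0: "v = 0\<^sub>v (s * t)"
    by (rule full_row_rank_imp_trivial_left_kernel[OF H rank v])
  have lt: "i * s + j < s * t"
  proof -
    have "i * s + j < Suc i * s" using ij by simp
    also have "\<dots> \<le> t * s" using ij by (intro mult_le_mono1) simp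
    finally show ?thesis by (simp add: mult.commute)
  qed
  have "c ((i * s + j) div s) ((i * s + j) mod s) = v $ (i * s + j)"
    unfolding v_def using lt by simp
  also have "\<dots> = 0" using v0 lt by simp
  finally show ?thesis using ij by simp
qed

lemma controllable_imp_left_kernel_trivial:
  assumes A: "A \<in> carrier_mat n n" and B: "B \<in> carrier_mat n m"
    and ctrl: "controllable A B" and \<xi>: "\<xi> \<in> carrier_vec n"
    and zero: "\<And>l j. l < n \<Longrightarrow> j < m \<Longrightarrow> \<xi> \<bullet> (A ^\<^sub>m l *\<^sub>v col B j) = 0"
  shows "\<xi> = 0\<^sub>v n"
proof -
  let ?K = "controllability_matrix A B"
  have K: "?K \<in> carrier_mat n (n * m)"
    using A B unfolding controllability_matrix_def Let_def by simp
  have rank: "vec_space.rank n ?K = n"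
    using ctrl A unfolding controllable_def by simp
  show ?thesis
  proof (rule full_row_rank_imp_trivial_left_kernel[OF K rank \<xi>])
    fix j assume j: "j < n * m"
    then have m: "m > 0" by (cases m) auto
    have lt: "j div m < n" "j mod m < m"
      using j m by (auto simp: less_mult_imp_div_less)
    have "col ?K j = A ^\<^sub>m (j div m) *\<^sub>v col B (j mod m)"
      using A B j lt by (intro eq_vecI)
        (auto simp: controllability_matrix_def Let_def)
    then show "\<xi> \<bullet> col ?K j = 0" using zero lt by simp
  qed
qed

section \<open>Full row rank of the state and input data\<close>

text \<open>
  The claim is needed for \<open>l = 0\<close> only. The power \<open>l\<close> is carried along because the
  induction peels off the last time step, which turns \<open>A\<^sup>l x\<close> into \<open>A\<^sup>l A x\<close>.
\<close>

lemma trajectory_unroll: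
  fixes A B :: "real mat"
  assumes A: "A \<in> carrier_mat n n" and B: "B \<in> carrier_mat n m"
    and x: "\<And>i. i \<le> j \<Longrightarrow> x (k + i) \<in> carrier_vec n"
    and u: "\<And>i. i < j \<Longrightarrow> u (k + i) \<in> carrier_vec m"
    and step: "\<And>i. i < j \<Longrightarrow> x (k + Suc i) = A *\<^sub>v x (k + i) + B *\<^sub>v u (k + i)"
    and \<xi>: "\<xi> \<in> carrier_vec n"
  shows "\<xi> \<bullet> (A ^\<^sub>m l *\<^sub>v x (k + j)) = \<xi> \<bullet> (A ^\<^sub>m (l + j) *\<^sub>v x k) +
    (\<Sum>i<j. \<xi> \<bullet> (A ^\<^sub>m (l + j - 1 - i) *\<^sub>v (B *\<^sub>v u (k + i))))"
  using x u step
proof (induction j arbitrary: l)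
  case 0
  then show ?case by simp
next
  case (Suc j)
  have xj: "x (k + j) \<in> carrier_vec n" and uj: "u (k + j) \<in> carrier_vec m"
    using Suc.prems by auto
  have Al: "A ^\<^sub>m l \<in> carrier_mat n n" using A by simp
  have Ax: "A *\<^sub>v x (k + j) \<in> carrier_vec n" and Bu: "B *\<^sub>v u (k + j) \<in> carrier_vec n"
    using A B xj uj by auto
  have "A ^\<^sub>m l *\<^sub>v x (k + Suc j) = A ^\<^sub>m l *\<^sub>v (A *\<^sub>v x (k + j)) + A ^\<^sub>m l *\<^sub>v (B *\<^sub>v u (k + j))"
    using Suc.prems(3)[of j] mult_add_distrib_mat_vec[OF Al Ax Bu] by simp
  also have "A ^\<^sub>m l *\<^sub>v (A *\<^sub>v x (k + j)) = A ^\<^sub>m Suc l *\<^sub>v x (k + j)"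
    using assoc_mult_mat_vec[OF Al A xj] by simp
  finally have "\<xi> \<bullet> (A ^\<^sub>m l *\<^sub>v x (k + Suc j)) =
      \<xi> \<bullet> (A ^\<^sub>m Suc l *\<^sub>v x (k + j)) + \<xi> \<bullet> (A ^\<^sub>m l *\<^sub>v (B *\<^sub>v u (k + j)))"
    using scalar_prod_add_distrib[OF \<xi>, of "A ^\<^sub>m Suc l *\<^sub>v x (k + j)"]
      mult_mat_vec_carrier[OF Al Bu] mult_mat_vec_carrier[OF pow_carrier_mat[OF A, of "Suc l"] xj]
    by simp
  also have "\<xi> \<bullet> (A ^\<^sub>m Suc l *\<^sub>v x (k + j)) = \<xi> \<bullet> (A ^\<^sub>m (Suc l + j) *\<^sub>v x k) +
      (\<Sum>i<j. \<xi> \<bullet> (A ^\<^sub>m (Suc l + j - 1 - i) *\<^sub>v (B *\<^sub>v u (k + i))))"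
    using Suc.prems by (intro Suc.IH) auto
  finally show ?case by simp
qed

text \<open>
  A triangular elimination. In the application \<open>\<beta> l\<close> is an entry of \<open>\<xi>\<^sup>T A\<^sup>l B\<close>, and \<open>win\<close>
  says that the coefficient of the input at offset \<open>i\<close> in the window vanishes. Let \<open>d\<close> be
  the largest index with \<open>a d \<noteq> 0\<close>. The offset \<open>d\<close> yields \<open>\<eta> = 0\<close>, and the offsets
  \<open>d - 1, ..., 0\<close> yield \<open>\<beta> 0 = 0, ..., \<beta> (d - 1) = 0\<close> in this order. From then on the recurrence
  \<open>rec\<close> of order \<open>d\<close> makes all later values vanish.
\<close>

lemma window_coefficients_vanish:
  fixes a \<beta> :: "nat \<Rightarrow> real"
  assumes nz: "j0 \<le> n" "a j0 \<noteq> 0"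
    and win: "\<And>i. i \<le> n \<Longrightarrow> a i * \<eta> + (\<Sum>j = Suc i..n. a j * \<beta> (j - 1 - i)) = 0"
    and rec: "\<And>e. (\<Sum>j\<le>n. a j * \<beta> (j + e)) = 0"
  shows "\<eta> = 0" "\<beta> l = 0"
proof -
  define d where "d = Max {j. j \<le> n \<and> a j \<noteq> 0}"
  have "d \<in> {j. j \<le> n \<and> a j \<noteq> 0}" unfolding d_def using nz by (intro Max_in) auto
  then have d: "d \<le> n" "a d \<noteq> 0" by auto
  have above: "a j = 0" if "d < j" "j \<le> n" for j
  proof (rule ccontr)
    assume "a j \<noteq> 0"
    then have "j \<le> d" unfolding d_def using that by (intro Max_ge) auto
    with that show False by simp
  qed
  have "(\<Sum>j = Suc d..n. a j * \<beta> (j - 1 - d)) = 0"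
    by (intro sum.neutral) (auto simp: above)
  then show \<eta>: "\<eta> = 0" using win[OF d(1)] d(2) by simp
  show "\<beta> l = 0"
  proof (induction l rule: less_induct)
    case (less l)
    \<comment> \<open>in both sums below only the index \<open>d\<close> contributes: smaller indices meet the
      induction hypothesis, larger ones a zero of \<open>a\<close>\<close>
    have single: "a d * \<beta> l = sum f J"
      if "finite J" "d \<in> J" "J \<subseteq> {..n}" "f d = a d * \<beta> l"
        "\<And>j. j \<in> J \<Longrightarrow> j < d \<Longrightarrow> f j = 0" "\<And>j. a j = 0 \<Longrightarrow> f j = 0" for f J
    proof -
      have "f j = 0" if "j \<in> J - {d}" for j
        using that \<open>J \<subseteq> {..n}\<close> above \<open>\<And>j. j \<in> J \<Longrightarrow> j < d \<Longrightarrow> f j = 0\<close> \<open>\<And>j. a j = 0 \<Longrightarrow> f j = 0\<close>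
        by (cases "j < d") auto
      then show ?thesis using sum.remove[OF that(1,2), of f] that(4) by simp
    qed
    have "a d * \<beta> l = 0"
    proof (cases "l < d")
      case True
      have "a d * \<beta> l = (\<Sum>j = Suc (d - 1 - l)..n. a j * \<beta> (j - 1 - (d - 1 - l)))"
        using True d by (intro single) (auto intro!: less.IH)
      then show ?thesis using win[of "d - 1 - l"] d(1) \<eta> by simp
    next
      case False
      have "a d * \<beta> l = (\<Sum>j\<le>n. a j * \<beta> (j + (l - d)))"
        using False d by (intro single) (auto intro!: less.IH)
      then show ?thesis using rec by simp
    qed
    then show ?case using d by simp
  qed
qed

lemma scalar_prod_mult_mat_vec_cols:
  fixes M B :: "real mat"
  assumes M: "M \<in> carrier_mat n n" and B: "B \<in> carrier_mat n m"
    and \<xi>: "\<xi> \<in> carrier_vec n" and v: "v \<in> carrier_vec m"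
  shows "\<xi> \<bullet> (M *\<^sub>v (B *\<^sub>v v)) = (\<Sum>s<m. (\<xi> \<bullet> (M *\<^sub>v col B s)) * v $ s)"
proof -
  have MB: "M * B \<in> carrier_mat n m" using M B by simp
  have "\<xi> \<bullet> (M *\<^sub>v (B *\<^sub>v v)) = ((M * B)\<^sup>T *\<^sub>v \<xi>) \<bullet> v"
    using transpose_vec_mult_scalar[OF MB v \<xi>] assoc_mult_mat_vec[OF M B v] by simp
  also have "\<dots> = (\<Sum>s<m. (col (M * B) s \<bullet> \<xi>) * v $ s)"
    using v M B unfolding scalar_prod_def[of _ v] by (auto intro!: sum.cong simp: atLeast0LessThan)
  also have "\<dots> = (\<Sum>s<m. (\<xi> \<bullet> (M *\<^sub>v col B s)) * v $ s)"
  proof (rule sum.cong[OF refl])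
    fix s assume "s \<in> {..<m}"
    then have "col (M * B) s = M *\<^sub>v col B s" using col_mult2[OF M B] by (metis lessThan_iff)
    moreover have "M *\<^sub>v col B s \<in> carrier_vec n" using M B by auto
    ultimately show "(col (M * B) s \<bullet> \<xi>) * v $ s = (\<xi> \<bullet> (M *\<^sub>v col B s)) * v $ s"
      using comm_scalar_prod[OF \<xi>] by simp
  qed
  finally show ?thesis .
qed

text \<open>
  This is the fundamental lemma of Willems for windows of length one: the stacked matrix of states
  and inputs has full row rank. If \<open>\<xi>\<close> and \<open>\<eta>\<close> annihilate all its columns, then in a
  window of \<open>n + 1\<close> consecutive times every state can be expressed by the first state of the
  window and the intermediate inputs. Weighting the relations with the coefficients of
  \<open>krylov_dependence\<close> cancels the first state and leaves a linear relation between the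
  \<open>n + 1\<close> inputs of the window. Its coefficients do not depend on the position of the
  window, so persistency of excitation makes them zero.
\<close>

lemma stacked_data_left_kernel_trivial:
  fixes A B :: "real mat" and x u :: "nat \<Rightarrow> real vec"
  assumes A: "A \<in> carrier_mat n n" and B: "B \<in> carrier_mat n m"
    and ctrl: "controllable A B"
    and pe: "persistently_exciting m T u (n + 1)"
    and x: "\<And>k. k \<le> T \<Longrightarrow> x k \<in> carrier_vec n"
    and u: "\<And>k. k < T \<Longrightarrow> u k \<in> carrier_vec m"
    and step: "\<And>k. k < T \<Longrightarrow> x (Suc k) = A *\<^sub>v x k + B *\<^sub>v u k"
    and \<xi>: "\<xi> \<in> carrier_vec n" and \<eta>: "\<eta> \<in> carrier_vec m"
    and zero: "\<And>k. k < T \<Longrightarrow> \<xi> \<bullet> x k + \<eta> \<bullet> u k = 0"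
  shows "\<xi> = 0\<^sub>v n" "\<eta> = 0\<^sub>v m"
proof -
  obtain a :: "nat \<Rightarrow> real" and j0 where a: "j0 \<le> n" "a j0 \<noteq> 0"
    "\<And>v. v \<in> carrier_vec n \<Longrightarrow> (\<Sum>j\<le>n. a j * (\<xi> \<bullet> (A ^\<^sub>m j *\<^sub>v v))) = 0"
    by (rule krylov_dependence[OF A \<xi>]) (rule that)
  define \<beta> where "\<beta> l s = \<xi> \<bullet> (A ^\<^sub>m l *\<^sub>v col B s)" for l s
  define c where "c i s = a i * \<eta> $ s + (\<Sum>j = Suc i..n. a j * \<beta> (j - 1 - i) s)" for i s
  have window: "(\<Sum>i<n + 1. \<Sum>s<m. c i s * u (k + i) $ s) = 0" if k: "k + (n + 1) \<le> T" for k
  proof -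
    define g where "g l i = (\<Sum>s<m. \<beta> l s * u (k + i) $ s)" for l i
    have term0: "a j * (\<xi> \<bullet> (A ^\<^sub>m j *\<^sub>v x k)) + (\<Sum>i<j. a j * g (j - 1 - i) i) +
        a j * (\<eta> \<bullet> u (k + j)) = 0" if j: "j \<le> n" for j
    proof -
      have "\<xi> \<bullet> x (k + j) = \<xi> \<bullet> (A ^\<^sub>m 0 *\<^sub>v x (k + j))"
        using x[of "k + j"] k j A by simp
      also have "\<dots> = \<xi> \<bullet> (A ^\<^sub>m (0 + j) *\<^sub>v x k) +
          (\<Sum>i<j. \<xi> \<bullet> (A ^\<^sub>m (0 + j - 1 - i) *\<^sub>v (B *\<^sub>v u (k + i))))"
        using k j x u step by (intro trajectory_unroll[OF A B _ _ _ \<xi>]) auto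
      also have "(\<Sum>i<j. \<xi> \<bullet> (A ^\<^sub>m (0 + j - 1 - i) *\<^sub>v (B *\<^sub>v u (k + i)))) =
          (\<Sum>i<j. g (j - 1 - i) i)"
        unfolding g_def \<beta>_def using k j u
        by (intro sum.cong refl) (simp add: scalar_prod_mult_mat_vec_cols[OF pow_carrier_mat[OF A] B \<xi>])
      finally have "\<xi> \<bullet> (A ^\<^sub>m j *\<^sub>v x k) + (\<Sum>i<j. g (j - 1 - i) i) + \<eta> \<bullet> u (k + j) = 0"
        using zero[of "k + j"] k j by simp
      then have "a j * (\<xi> \<bullet> (A ^\<^sub>m j *\<^sub>v x k) + (\<Sum>i<j. g (j - 1 - i) i) + \<eta> \<bullet> u (k + j)) = 0"
        by simp
      then show ?thesis by (simp only: distrib_left sum_distrib_left)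
    qed
    have "0 = (\<Sum>j\<le>n. a j * (\<xi> \<bullet> (A ^\<^sub>m j *\<^sub>v x k)) + (\<Sum>i<j. a j * g (j - 1 - i) i) +
        a j * (\<eta> \<bullet> u (k + j)))"
      using term0 by simp
    also have "\<dots> = (\<Sum>j\<le>n. a j * (\<xi> \<bullet> (A ^\<^sub>m j *\<^sub>v x k))) +
        (\<Sum>j\<le>n. \<Sum>i<j. a j * g (j - 1 - i) i) + (\<Sum>j\<le>n. a j * (\<eta> \<bullet> u (k + j)))"
      by (simp add: sum.distrib)
    also have "(\<Sum>j\<le>n. a j * (\<xi> \<bullet> (A ^\<^sub>m j *\<^sub>v x k))) = 0" using a(3) x k by simp
    \<comment> \<open>collect by input offset \<open>i\<close> instead of state offset \<open>j\<close>\<close>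
    also have "(\<Sum>j\<le>n. \<Sum>i<j. a j * g (j - 1 - i) i) =
        (\<Sum>i\<le>n. \<Sum>j = Suc i..n. a j * g (j - 1 - i) i)"
      by (subst sum.nested_swap') (simp add: lessThan_Suc_atMost[symmetric])
    also have "0 + (\<Sum>i\<le>n. \<Sum>j = Suc i..n. a j * g (j - 1 - i) i) +
        (\<Sum>j\<le>n. a j * (\<eta> \<bullet> u (k + j))) =
        (\<Sum>i\<le>n. (\<Sum>j = Suc i..n. a j * g (j - 1 - i) i) + a i * (\<eta> \<bullet> u (k + i)))"
      by (simp add: sum.distrib)
    also have "\<dots> = (\<Sum>i<n + 1. \<Sum>s<m. c i s * u (k + i) $ s)"
    proof (rule sum.cong)
      fix i assume "i \<in> {..<n + 1}"
      then have "u (k + i) \<in> carrier_vec m" using u k by simp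
      then have "\<eta> \<bullet> u (k + i) = (\<Sum>s<m. \<eta> $ s * u (k + i) $ s)"
        unfolding scalar_prod_def by (simp add: atLeast0LessThan)
      moreover have "(\<Sum>j = Suc i..n. a j * g (j - 1 - i) i) =
          (\<Sum>s<m. \<Sum>j = Suc i..n. a j * \<beta> (j - 1 - i) s * u (k + i) $ s)"
        unfolding g_def sum_distrib_left mult.assoc by (rule sum.swap)
      ultimately show "(\<Sum>j = Suc i..n. a j * g (j - 1 - i) i) + a i * (\<eta> \<bullet> u (k + i)) =
          (\<Sum>s<m. c i s * u (k + i) $ s)"
        unfolding c_def by (simp add: distrib_right sum.distrib sum_distrib_left sum_distrib_right
            mult.assoc add.commute)
    qed auto
    finally show ?thesis by simp
  qed
  have "c i s = 0" if "i \<le> n" "s < m" for i s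
    using persistently_exciting_coeff_zero[OF pe window] that by simp
  then have win: "a i * \<eta> $ s + (\<Sum>j = Suc i..n. a j * \<beta> (j - 1 - i) s) = 0"
    if "i \<le> n" "s < m" for i s using that unfolding c_def by simp
  have pow_add: "A ^\<^sub>m j *\<^sub>v (A ^\<^sub>m e *\<^sub>v v) = A ^\<^sub>m (j + e) *\<^sub>v v"
    if v: "v \<in> carrier_vec n" for j e v
    using v
  proof (induction e arbitrary: v)
    case (Suc e)
    have Av: "A *\<^sub>v v \<in> carrier_vec n" using A Suc.prems by auto
    show ?case using Suc.IH[OF Av] A Suc.prems
      by (simp add: assoc_mult_mat_vec[of _ n n])
  qed (use A in auto)
  have rec: "(\<Sum>j\<le>n. a j * \<beta> (j + e) s) = 0" if "s < m" for e s
  proof -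
    have cB: "col B s \<in> carrier_vec n" using B by auto
    have "A ^\<^sub>m e *\<^sub>v col B s \<in> carrier_vec n"
      using mult_mat_vec_carrier[OF pow_carrier_mat[OF A] cB] .
    from a(3)[OF this] show ?thesis unfolding \<beta>_def by (simp add: pow_add[OF cB])
  qed
  have \<eta>0: "\<eta> $ s = 0" and \<beta>0: "\<beta> l s = 0" if "s < m" for l s
    using window_coefficients_vanish[where a = a and \<eta> = "\<eta> $ s" and \<beta> = "\<lambda>l. \<beta> l s",
        OF a(1,2) win[OF _ that] rec[OF that]] by auto
  show "\<eta> = 0\<^sub>v m" using \<eta>0 \<eta> by (intro eq_vecI) auto
  show "\<xi> = 0\<^sub>v n"
    using controllable_imp_left_kernel_trivial[OF A B ctrl \<xi>] \<beta>0 unfolding \<beta>_def by blast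
qed

section \<open>The steady-state gain from data\<close>

lemma cols_lin_indpt_imp_injective:
  assumes C: "C \<in> carrier_mat p n" and li: "cols_lin_indpt C"
    and v: "v \<in> carrier_vec n" "C *\<^sub>v v = 0\<^sub>v p"
  shows "v = 0\<^sub>v n"
proof (rule ccontr)
  interpret V: vec_space "TYPE(real)" p .
  assume "v \<noteq> 0\<^sub>v n"
  from V.lin_depI[OF C v(1) this v(2)] show False
    using li C unfolding cols_lin_indpt_def by auto
qed

lemma cols_lin_indpt_mult_eq_0:
  assumes C: "C \<in> carrier_mat p n" and li: "cols_lin_indpt C"
    and D: "D \<in> carrier_mat n m" and CD: "C * D = 0\<^sub>m p m"
  shows "D = 0\<^sub>m n m"
proof (rule mat_col_eqI)
  fix j assume "j < dim_col (0\<^sub>m n m :: real mat)"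
  then have j: "j < m" by simp
  have "C *\<^sub>v col D j = col (C * D) j" using col_mult2[OF C D j] by simp
  then have "C *\<^sub>v col D j = 0\<^sub>v p" using CD j by simp
  then have "col D j = 0\<^sub>v n"
    using cols_lin_indpt_imp_injective[OF C li, of "col D j"] D by auto
  then show "col D j = col (0\<^sub>m n m) j" using j by simp
qed (use D in auto)

lemma mult_mat_of_cols:
  assumes C: "C \<in> carrier_mat p n" and x: "\<And>k. k < T \<Longrightarrow> x k \<in> carrier_vec n"
  shows "C * mat_of_cols n (map x [0..<T]) = mat_of_cols p (map (\<lambda>k. C *\<^sub>v x k) [0..<T])"
proof (rule mat_col_eqI)
  fix k assume "k < dim_col (mat_of_cols p (map (\<lambda>k. C *\<^sub>v x k) [0..<T]))"
  then have k: "k < T" by simp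
  have X: "mat_of_cols n (map x [0..<T]) \<in> carrier_mat n T"
    using mat_of_cols_carrier(1)[of n "map x [0..<T]"] by simp
  have "C *\<^sub>v x k \<in> carrier_vec p" using C x[OF k] by auto
  then show "col (C * mat_of_cols n (map x [0..<T])) k =
      col (mat_of_cols p (map (\<lambda>k. C *\<^sub>v x k) [0..<T])) k"
    using col_mult2[OF C X k] x[OF k] k by (simp add: col_mat_of_cols)
qed (use C in auto)

text \<open>
  Consequence of the full row rank: states and inputs can be combined linearly, with the same
  weights \<open>M\<close>, to any prescribed pair of values.
\<close>

lemma data_right_inverse:
  fixes A B W V :: "real mat" and x u :: "nat \<Rightarrow> real vec"
  assumes A: "A \<in> carrier_mat n n" and B: "B \<in> carrier_mat n m"
    and ctrl: "controllable A B"
    and pe: "persistently_exciting m T u (n + 1)"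
    and x: "\<And>k. k \<le> T \<Longrightarrow> x k \<in> carrier_vec n"
    and u: "\<And>k. k < T \<Longrightarrow> u k \<in> carrier_vec m"
    and step: "\<And>k. k < T \<Longrightarrow> x (Suc k) = A *\<^sub>v x k + B *\<^sub>v u k"
    and W: "W \<in> carrier_mat n q" and V: "V \<in> carrier_mat m q"
  obtains M where "M \<in> carrier_mat T q"
    "mat_of_cols n (map x [0..<T]) * M = W" "mat_of_cols m (map u [0..<T]) * M = V"
proof -
  let ?X = "mat_of_cols n (map x [0..<T])" and ?U = "mat_of_cols m (map u [0..<T])"
  let ?K = "mat_of_cols (n + m) (map (\<lambda>k. x k @\<^sub>v u k) [0..<T])"
  let ?R = "W @\<^sub>r V"
  have K: "?K \<in> carrier_mat (n + m) T"
    using mat_of_cols_carrier(1)[of "n + m" "map (\<lambda>k. x k @\<^sub>v u k) [0..<T]"] by simp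
  have R: "?R \<in> carrier_mat (n + m) q" using W V by simp
  obtain M where M: "M \<in> carrier_mat T q" "?K * M = ?R"
  proof (rule right_inverse_of_trivial_left_kernel[OF K R])
    fix v assume v: "v \<in> carrier_vec (n + m)" "?K\<^sup>T *\<^sub>v v = 0\<^sub>v T"
    define \<xi> \<eta> where "\<xi> = vec_first v n" and "\<eta> = vec_last v m"
    have \<xi>: "\<xi> \<in> carrier_vec n" and \<eta>: "\<eta> \<in> carrier_vec m"
      unfolding \<xi>_def \<eta>_def by auto
    have split: "v = \<xi> @\<^sub>v \<eta>" unfolding \<xi>_def \<eta>_def using v(1) by simp
    have "\<xi> \<bullet> x k + \<eta> \<bullet> u k = 0" if k: "k < T" for k
    proof -
      have xk: "x k \<in> carrier_vec n" and uk: "u k \<in> carrier_vec m" using x u k by auto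
      have "0 = (?K\<^sup>T *\<^sub>v v) $ k" using v(2) k by simp
      also have "\<dots> = col ?K k \<bullet> v" using k by simp
      also have "col ?K k = x k @\<^sub>v u k" using k xk uk by (subst col_mat_of_cols) auto
      also have "(x k @\<^sub>v u k) \<bullet> v = x k \<bullet> \<xi> + u k \<bullet> \<eta>"
        unfolding split by (rule scalar_prod_append[OF xk uk \<xi> \<eta>])
      finally show ?thesis
        using comm_scalar_prod[OF xk \<xi>] comm_scalar_prod[OF uk \<eta>] by simp
    qed
    from stacked_data_left_kernel_trivial[OF A B ctrl pe x u step \<xi> \<eta> this]
    show "v = 0\<^sub>v (n + m)" unfolding split by auto
  qed
  have rowX: "row ?X i = row ?K i" if "i < n" for i
  proof (rule eq_vecI)
    fix k assume "k < dim_vec (row ?K i)"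
    then have k: "k < T" by simp
    then have "dim_vec (x k) = n" "dim_vec (u k) = m" using x[of k] u[of k] by auto
    then show "row ?X i $ k = row ?K i $ k"
      using that k by (simp add: mat_of_cols_index)
  qed simp
  have rowU: "row ?U i = row ?K (n + i)" if "i < m" for i
  proof (rule eq_vecI)
    fix k assume "k < dim_vec (row ?K (n + i))"
    then have k: "k < T" by simp
    then have "dim_vec (x k) = n" "dim_vec (u k) = m" using x[of k] u[of k] by auto
    then show "row ?U i $ k = row ?K (n + i) $ k"
      using that k by (simp add: mat_of_cols_index)
  qed simp
  have "?X * M = W"
  proof (rule eq_matI)
    fix i j assume ij: "i < dim_row W" "j < dim_col W"
    then have "(?X * M) $$ (i, j) = (?K * M) $$ (i, j)"
      using W M(1) rowX by simp
    then show "(?X * M) $$ (i, j) = W $$ (i, j)"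
      using M(2) ij W V by (simp add: append_rows_def)
  qed (use W M in auto)
  moreover have "?U * M = V"
  proof (rule eq_matI)
    fix i j assume ij: "i < dim_row V" "j < dim_col V"
    then have "(?U * M) $$ (i, j) = (?K * M) $$ (n + i, j)"
      using V M(1) rowU by simp
    then show "(?U * M) $$ (i, j) = V $$ (i, j)"
      using M(2) ij W V by (simp add: append_rows_def)
  qed (use V M in auto)
  ultimately show thesis using that M(1) by blast
qed

theorem mainTheorem1:
  fixes n m r p T :: nat
    and A B C E :: "real mat"
    and x u w y :: "nat \<Rightarrow> real vec"
    and U Y Ydiff :: "real mat"
  assumes "A \<in> carrier_mat n n" and "B \<in> carrier_mat n m"
    and "C \<in> carrier_mat p n" and "E \<in> carrier_mat n r"
    and "schur_stable A"
    and "controllable A B"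
    and "cols_lin_indpt C"
    and "T > 0"
    and "\<And>k. k < T \<Longrightarrow> u k \<in> carrier_vec m"
    and "persistently_exciting m T u (n + 1)"
    and "\<And>k. k < T \<Longrightarrow> w k = 0\<^sub>v r"
    and "system_trajectory A B C E T x u w y"
    and "U = mat_of_cols m (map u [0..<T])"
    and "Y = mat_of_cols p (map y [0..<T])"
    and "Ydiff = mat_of_cols p (map (\<lambda>k. y (Suc k) - y k) [0..<T])"
  shows "(\<exists>M \<in> carrier_mat T m. Ydiff * M = 0\<^sub>m p m \<and> U * M = 1\<^sub>m m) \<and>
    (\<forall>M \<in> carrier_mat T m. Ydiff * M = 0\<^sub>m p m \<and> U * M = 1\<^sub>m m \<longrightarrow>
       steady_state_gain A B C = Y * M)"
proof -
  note A = assms(1) and B = assms(2) and C = assms(3) and E = assms(4) and u = assms(9)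
  have traj: "x 0 \<in> carrier_vec n"
    "\<And>k. k < T \<Longrightarrow> x (Suc k) = A *\<^sub>v x k + B *\<^sub>v u k + E *\<^sub>v w k"
    "\<And>k. k \<le> T \<Longrightarrow> y k = C *\<^sub>v x k"
    using assms(12) A unfolding system_trajectory_def by auto
  have Ew: "E *\<^sub>v w k = 0\<^sub>v n" if "k < T" for k
    using assms(11)[OF that] E by auto
  have x: "x k \<in> carrier_vec n" if "k \<le> T" for k
    using that
  proof (induction k)
    case (Suc k)
    then show ?case using traj(2)[of k] Ew[of k] A B u[of k] by auto
  qed (use traj(1) in simp)
  have step: "x (Suc k) = A *\<^sub>v x k + B *\<^sub>v u k" if k: "k < T" for k
  proof -
    have "A *\<^sub>v x k + B *\<^sub>v u k \<in> carrier_vec n" using A B x[of k] u[OF k] k by auto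
    then show ?thesis using traj(2)[OF k] Ew[OF k] by simp
  qed
  define X where "X = mat_of_cols n (map x [0..<T])"
  have X: "X \<in> carrier_mat n T" and U: "U \<in> carrier_mat m T"
    using mat_of_cols_carrier(1)[of n "map x [0..<T]"] mat_of_cols_carrier(1)[of m "map u [0..<T]"]
    unfolding X_def assms(13) by auto
  have Y: "Y = C * X"
    unfolding assms(14) X_def using x traj(3)
    by (subst mult_mat_of_cols[OF C]) (auto intro!: arg_cong[where f = "mat_of_cols p"])
  have AX: "A * X = mat_of_cols n (map (\<lambda>k. A *\<^sub>v x k) [0..<T])"
    unfolding X_def using x by (intro mult_mat_of_cols[OF A]) auto
  have BU: "B * U = mat_of_cols n (map (\<lambda>k. B *\<^sub>v u k) [0..<T])"
    unfolding assms(13) using u by (intro mult_mat_of_cols[OF B]) auto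
  have Xdiff: "A * X + B * U - X = mat_of_cols n (map (\<lambda>k. x (Suc k) - x k) [0..<T])"
  proof (rule eq_matI)
    fix i k
    assume "i < dim_row (mat_of_cols n (map (\<lambda>k. x (Suc k) - x k) [0..<T]))"
      "k < dim_col (mat_of_cols n (map (\<lambda>k. x (Suc k) - x k) [0..<T]))"
    then have i: "i < n" and k: "k < T" by auto
    have "dim_vec (x k) = n" using x[of k] k by auto
    then show "(A * X + B * U - X) $$ (i, k) =
        mat_of_cols n (map (\<lambda>k. x (Suc k) - x k) [0..<T]) $$ (i, k)"
      unfolding AX BU unfolding X_def using i k step[OF k] A B
      by (simp add: mat_of_cols_index)
  qed (auto simp: X_def BU)
  have "C *\<^sub>v (x (Suc k) - x k) = y (Suc k) - y k" if "k < T" for k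
    using mult_minus_distrib_mat_vec[OF C x[of "Suc k"] x[of k]] traj(3) that by simp
  moreover have "C * (A * X + B * U - X) =
      mat_of_cols p (map (\<lambda>k. C *\<^sub>v (x (Suc k) - x k)) [0..<T])"
    unfolding Xdiff using x by (intro mult_mat_of_cols[OF C]) auto
  ultimately have Ydiff: "Ydiff = C * (A * X + B * U - X)"
    unfolding assms(15) by (auto intro!: arg_cong[where f = "mat_of_cols p"])
  obtain N where N: "mat_inverse (1\<^sub>m n - A) = Some N" "N \<in> carrier_mat n n"
    "(1\<^sub>m n - A) * N = 1\<^sub>m n" "N * (1\<^sub>m n - A) = 1\<^sub>m n"
    using schur_stable_mat_inverse[OF A assms(5)] .
  have gain: "steady_state_gain A B C = C * (N * B)"
    unfolding steady_state_gain_def using A B C N(1,2) by simp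
  have IA: "1\<^sub>m n - A \<in> carrier_mat n n" using A by auto
  have YdiffM: "Ydiff * M = C * (B - (1\<^sub>m n - A) * (X * M))"
    if M: "M \<in> carrier_mat T m" and UM: "U * M = 1\<^sub>m m" for M
  proof -
    have XM: "X * M \<in> carrier_mat n m" using X M by simp
    have "(A * X + B * U - X) * M = A * (X * M) + B * (U * M) - X * M"
      using A B X U M
      by (simp add: minus_mult_distrib_mat[of _ n T] add_mult_distrib_mat[of _ n T]
          assoc_mult_mat[of _ n n _ T] assoc_mult_mat[of _ n m _ T])
    also have "\<dots> = B - (X * M - A * (X * M))"
    proof -
      have "Q + B - P = B - (P - Q)" if "P \<in> carrier_mat n m" "Q \<in> carrier_mat n m" for P Q
        using B that by (intro eq_matI) auto
      then show ?thesis
        unfolding UM right_mult_one_mat[OF B] using XM mult_carrier_mat[OF A XM] by blast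
    qed
    also have "X * M - A * (X * M) = (1\<^sub>m n - A) * (X * M)"
      using minus_mult_distrib_mat[OF one_carrier_mat A XM] left_mult_one_mat[OF XM] by simp
    finally show ?thesis
      unfolding Ydiff using C A X B U M by (subst assoc_mult_mat[of _ p n _ T]) auto
  qed
  show ?thesis
  proof (intro conjI ballI impI)
    have NB: "N * B \<in> carrier_mat n m" using N B by simp
    obtain M where M: "M \<in> carrier_mat T m" "X * M = N * B" "U * M = 1\<^sub>m m"
      using data_right_inverse[OF A B assms(6,10) x u step NB one_carrier_mat]
      unfolding X_def assms(13) .
    have "(1\<^sub>m n - A) * (N * B) = B"
      using assoc_mult_mat[OF IA N(2) B] N(3) B by simp
    then have "Ydiff * M = C * (B - B)" using YdiffM[OF M(1,3)] M(2) by simp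
    also have "\<dots> = 0\<^sub>m p m" using B C by simp
    finally show "\<exists>M \<in> carrier_mat T m. Ydiff * M = 0\<^sub>m p m \<and> U * M = 1\<^sub>m m"
      using M by blast
  next
    fix M assume M: "M \<in> carrier_mat T m" and eqs: "Ydiff * M = 0\<^sub>m p m \<and> U * M = 1\<^sub>m m"
    have XM: "X * M \<in> carrier_mat n m" using X M by simp
    have P: "(1\<^sub>m n - A) * (X * M) \<in> carrier_mat n m" using IA XM by simp
    then have D: "B - (1\<^sub>m n - A) * (X * M) \<in> carrier_mat n m" by (rule minus_carrier_mat)
    have "B - (1\<^sub>m n - A) * (X * M) = 0\<^sub>m n m"
      using cols_lin_indpt_mult_eq_0[OF C assms(7) D] YdiffM[OF M] eqs by simp
    then have "(B - (1\<^sub>m n - A) * (X * M)) $$ (i, j) = 0" if "i < n" "j < m" for i j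
      using that by simp
    then have "B $$ (i, j) = ((1\<^sub>m n - A) * (X * M)) $$ (i, j)" if "i < n" "j < m" for i j
      using that P by (metis carrier_matD eq_iff_diff_eq_0 index_minus_mat(1))
    then have "B = (1\<^sub>m n - A) * (X * M)" using B P by (intro eq_matI) (metis carrier_matD)+
    then have "N * B = X * M"
      using assoc_mult_mat[OF N(2) IA XM] N(4) left_mult_one_mat[OF XM] by simp
    then show "steady_state_gain A B C = Y * M"
      unfolding gain Y using assoc_mult_mat[OF C X M] by simp
  qed
qed

end
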